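(* Let $u_{x,y}$ be a quasi-definite generalized kernel with biorthogonal polynomials $P_{1,k},P_{2,k}$ and Christoffel–Darboux kernels $K_n$. Let $n\ge0$. (1) For any $m\in\{0,1,2,\dots\}$ and any complex coefficients $\lambda_0,\dots,\lambda_m$ (with the convention $\lambda_j=0$ for $j>m$), $$\Big\langle K_n(x,z),\sum_{j=0}^m\lambda_jP_{2,j}(y)\Big\rangle_u=\sum_{j=0}^n\lambda_jP_{2,j}(z),\qquad \Big\langle\sum_{j=0}^m\lambda_jP_{1,j}(x),K_n(z,y)\Big\rangle_u=\sum_{j=0}^n\lambda_jP_{1,j}(z).$$ (2) In particular, $\langle K_n(x,z),y^l\rangle_u=z^l$ for $l\in\{0,1,\dots,n\}$.
   Context: A generalized kernel $u_{x,y}$ is a linear functional on $\mathbb{C}[x,y]$ with associated bilinear form $\langle P(x),Q(y)\rangle_u=u(P(x)Q(y))$; the form acts on the variables $x$ (first argument) and $y$ (second argument), $z$ being a parameter. The Gram matrix is $G_{k,l}=\langle x^k,y^l\rangle_u$, $k,l\ge0$; quasi-definite means that all its leading principal minors are nonzero; then uniquely $G=S_1^{-1}HS_2^{-\top}$ with $S_1,S_2$ lower unitriangular and $H=\operatorname{diag}(H_0,H_1,\dots)$. With $\chi(x)=(1,x,x^2,\dots)^\top$, $P_{i,k}$ is the $k$-th entry of $S_i\chi$. The Christoffel–Darboux kernel is $K_n(x,y)=\sum_{k=0}^nP_{2,k}(y)H_k^{-1}P_{1,k}(x)$. *)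

theory Defs
  imports
    Complex_Main
    "HOL-Library.Groups_Big_Fun"
    "HOL-Computational_Algebra.Polynomial"
    "Jordan_Normal_Form.Determinant"
begin

section \<open>Generalized kernels\<close>

text \<open>
  The ring of polynomials in two variables with complex coefficients is rendered as
  \<^typ>\<open>complex poly poly\<close>: the coefficients are polynomials in the first variable \<open>x\<close>,
  and the outer variable is the second variable \<open>y\<close>.
\<close>

text \<open>The product \<open>P(x) Q(y)\<close>.\<close>

definition bivar_prod :: "complex poly \<Rightarrow> complex poly \<Rightarrow> complex poly poly" where
  "bivar_prod P Q = smult P (map_poly (\<lambda>c. [:c:]) Q)"

text \<open>Partial evaluations, \<open>F(x, z)\<close> as a polynomial in \<open>x\<close> and \<open>F(z, y)\<close> as a polynomial in \<open>y\<close>.\<close>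

definition eval_snd :: "complex poly poly \<Rightarrow> complex \<Rightarrow> complex poly" where
  "eval_snd F z = poly F [:z:]"

definition eval_fst :: "complex poly poly \<Rightarrow> complex \<Rightarrow> complex poly" where
  "eval_fst F z = map_poly (\<lambda>p. poly p z) F"

definition generalized_kernel :: "(complex poly poly \<Rightarrow> complex) \<Rightarrow> bool" where
  "generalized_kernel u \<longleftrightarrow> Vector_Spaces.linear (\<lambda>c. smult [:c:]) (*) u"

definition kform :: "(complex poly poly \<Rightarrow> complex) \<Rightarrow> complex poly \<Rightarrow> complex poly \<Rightarrow> complex" where
  "kform u P Q = u (bivar_prod P Q)"


section \<open>Semi-infinite matrices\<close>

type_synonym smat = "nat \<Rightarrow> nat \<Rightarrow> complex"

text \<open>
  Products are only ever formed when every entry is a sum with finitely many nonzero terms;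
  \<^const>\<open>Sum_any\<close> is then the actual sum.
\<close>

definition smat_mult :: "smat \<Rightarrow> smat \<Rightarrow> smat" where
  "smat_mult A B = (\<lambda>i j. Sum_any (\<lambda>k. A i k * B k j))"

definition smat_one :: smat where
  "smat_one = (\<lambda>i j. if i = j then 1 else 0)"

definition smat_diag :: "(nat \<Rightarrow> complex) \<Rightarrow> smat" where
  "smat_diag d = (\<lambda>i j. if i = j then d i else 0)"

definition smat_transpose :: "smat \<Rightarrow> smat" where
  "smat_transpose A = (\<lambda>i j. A j i)"

definition lower_unitriangular :: "smat \<Rightarrow> bool" where
  "lower_unitriangular A \<longleftrightarrow> (\<forall>i j. i < j \<longrightarrow> A i j = 0) \<and> (\<forall>i. A i i = 1)"

text \<open>
  The inverse of a lower unitriangular matrix in the group of all such matrices; see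
  \<open>lower_unitriangular_inverse_ex1\<close> below.
\<close>

definition smat_inv :: "smat \<Rightarrow> smat" where
  "smat_inv S = (THE T. lower_unitriangular T \<and> smat_mult S T = smat_one \<and> smat_mult T S = smat_one)"

definition leading_minor :: "smat \<Rightarrow> nat \<Rightarrow> complex" where
  "leading_minor G n = det (mat n n (\<lambda>(i, j). G i j))"


section \<open>Gauss--Borel factorization and biorthogonal polynomials\<close>

definition gram :: "(complex poly poly \<Rightarrow> complex) \<Rightarrow> smat" where
  "gram u = (\<lambda>k l. kform u (monom 1 k) (monom 1 l))"

definition quasi_definite :: "(complex poly poly \<Rightarrow> complex) \<Rightarrow> bool" where
  "quasi_definite u \<longleftrightarrow> (\<forall>n\<ge>1. leading_minor (gram u) n \<noteq> 0)"

definition gauss_borel :: "smat \<Rightarrow> smat \<Rightarrow> (nat \<Rightarrow> complex) \<Rightarrow> smat \<Rightarrow> bool" where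
  "gauss_borel G S1 H S2 \<longleftrightarrow> lower_unitriangular S1 \<and> lower_unitriangular S2 \<and>
     G = smat_mult (smat_mult (smat_inv S1) (smat_diag H)) (smat_transpose (smat_inv S2))"

text \<open>
  For a quasi-definite kernel exactly one triple is described here; see
  \<open>gauss_borel_ex1\<close> below.
\<close>

definition gb_factors :: "(complex poly poly \<Rightarrow> complex) \<Rightarrow> smat \<times> (nat \<Rightarrow> complex) \<times> smat" where
  "gb_factors u = (THE (S1, H, S2). gauss_borel (gram u) S1 H S2)"

definition S1_of :: "(complex poly poly \<Rightarrow> complex) \<Rightarrow> smat" where
  "S1_of u = fst (gb_factors u)"

definition H_of :: "(complex poly poly \<Rightarrow> complex) \<Rightarrow> nat \<Rightarrow> complex" where
  "H_of u = fst (snd (gb_factors u))"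

definition S2_of :: "(complex poly poly \<Rightarrow> complex) \<Rightarrow> smat" where
  "S2_of u = snd (snd (gb_factors u))"

definition chi :: "nat \<Rightarrow> complex poly" where
  "chi j = monom 1 j"

text \<open>The product of a row-finite matrix with a column vector of polynomials.\<close>

definition smat_mult_vec :: "smat \<Rightarrow> (nat \<Rightarrow> complex poly) \<Rightarrow> nat \<Rightarrow> complex poly" where
  "smat_mult_vec S v = (\<lambda>k. Sum_any (\<lambda>j. smult (S k j) (v j)))"

definition P1 :: "(complex poly poly \<Rightarrow> complex) \<Rightarrow> nat \<Rightarrow> complex poly" where
  "P1 u = smat_mult_vec (S1_of u) chi"

definition P2 :: "(complex poly poly \<Rightarrow> complex) \<Rightarrow> nat \<Rightarrow> complex poly" where
  "P2 u = smat_mult_vec (S2_of u) chi"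

definition CD_kernel :: "(complex poly poly \<Rightarrow> complex) \<Rightarrow> nat \<Rightarrow> complex poly poly" where
  "CD_kernel u n = (\<Sum>k\<le>n. smult [:inverse (H_of u k):] (bivar_prod (P1 u k) (P2 u k)))"


section \<open>Existence and uniqueness of inverse and factorization\<close>

lemma smat_mult_finite:
  assumes "\<And>k. k > n \<Longrightarrow> A i k * B k j = 0"
  shows "smat_mult A B i j = (\<Sum>k\<le>n. A i k * B k j)"
  unfolding smat_mult_def
  by (rule Sum_any.expand_superset) (use assms in \<open>auto simp: not_le[symmetric]\<close>)

definition lower_triangular :: "smat \<Rightarrow> bool" where
  "lower_triangular A \<longleftrightarrow> (\<forall>i j. i < j \<longrightarrow> A i j = 0)"

lemma lower_unitriangular_imp: "lower_unitriangular A \<Longrightarrow> lower_triangular A"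
  by (auto simp: lower_unitriangular_def lower_triangular_def)

lemma smat_mult_lower:
  assumes "lower_triangular A"
  shows "smat_mult A B i j = (\<Sum>k\<le>i. A i k * B k j)"
  by (rule smat_mult_finite) (use assms in \<open>auto simp: lower_triangular_def\<close>)

lemma lower_triangular_mult:
  assumes "lower_triangular A" "lower_triangular B"
  shows "lower_triangular (smat_mult A B)"
  using assms unfolding lower_triangular_def[of "smat_mult A B"]
  by (auto simp: smat_mult_lower intro!: sum.neutral) (simp add: lower_triangular_def)

lemma smat_mult_assoc:
  assumes A: "lower_triangular A" and B: "lower_triangular B"
  shows "smat_mult (smat_mult A B) C = smat_mult A (smat_mult B C)"
proof (intro ext)
  fix i j
  have "smat_mult (smat_mult A B) C i j = (\<Sum>k\<le>i. \<Sum>l\<le>i. A i l * B l k * C k j)"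
    by (simp add: smat_mult_lower[OF lower_triangular_mult[OF A B]] smat_mult_lower[OF A]
        sum_distrib_right)
  also have "\<dots> = (\<Sum>l\<le>i. \<Sum>k\<le>i. A i l * B l k * C k j)"
    by (rule sum.swap)
  also have "\<dots> = (\<Sum>l\<le>i. \<Sum>k\<le>l. A i l * B l k * C k j)"
  proof (rule sum.cong[OF refl])
    fix l assume "l \<in> {..i}"
    thus "(\<Sum>k\<le>i. A i l * B l k * C k j) = (\<Sum>k\<le>l. A i l * B l k * C k j)"
      by (intro sum.mono_neutral_right) (use B in \<open>auto simp: lower_triangular_def\<close>)
  qed
  also have "\<dots> = smat_mult A (smat_mult B C) i j"
    by (simp add: smat_mult_lower[OF A] smat_mult_lower[OF B] sum_distrib_left mult.assoc)
  finally show "smat_mult (smat_mult A B) C i j = smat_mult A (smat_mult B C) i j" .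
qed

lemma lower_triangular_one: "lower_triangular smat_one"
  by (auto simp: smat_one_def lower_triangular_def)

lemma lower_triangular_diag: "lower_triangular (smat_diag d)"
  by (auto simp: smat_diag_def lower_triangular_def)

lemma smat_one_left: "smat_mult smat_one A = A"
  by (intro ext, subst smat_mult_lower[OF lower_triangular_one])
     (auto simp: smat_one_def if_distrib[of "\<lambda>x. x * _"] cong: if_cong)

lemma smat_one_right: "lower_triangular A \<Longrightarrow> smat_mult A smat_one = A"
  by (intro ext)
     (auto simp: smat_mult_lower smat_one_def lower_triangular_def if_distrib[of "\<lambda>x. _ * x"]
       cong: if_cong)

lemma smat_diag_left: "smat_mult (smat_diag d) A = (\<lambda>i j. d i * A i j)"
  by (intro ext, subst smat_mult_lower[OF lower_triangular_diag])
     (auto simp: smat_diag_def if_distrib[of "\<lambda>x. x * _"] cong: if_cong)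

lemma smat_diag_right: "lower_triangular A \<Longrightarrow> smat_mult A (smat_diag d) = (\<lambda>i j. A i j * d j)"
  by (intro ext)
     (auto simp: smat_mult_lower smat_diag_def lower_triangular_def if_distrib[of "\<lambda>x. _ * x"]
       cong: if_cong)

fun forward_subst :: "smat \<Rightarrow> nat \<Rightarrow> nat \<Rightarrow> complex" where
  "forward_subst S i j = smat_one i j - (\<Sum>k<i. S i k * forward_subst S k j)"

declare forward_subst.simps [simp del]

lemma forward_subst_lower_unitriangular: "lower_unitriangular (forward_subst S)"
proof -
  have "(i < j \<longrightarrow> forward_subst S i j = 0) \<and> (i = j \<longrightarrow> forward_subst S i j = 1)" for i j
  proof (induction i rule: less_induct)
    case (less i)
    have "i \<le> j \<Longrightarrow> (\<Sum>k<i. S i k * forward_subst S k j) = 0"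
      using less by (intro sum.neutral) auto
    thus ?case by (subst (1 2) forward_subst.simps) (auto simp: smat_one_def)
  qed
  thus ?thesis by (auto simp: lower_unitriangular_def)
qed

lemma forward_subst_right_inverse:
  assumes "lower_unitriangular S"
  shows "smat_mult S (forward_subst S) = smat_one"
proof (intro ext)
  fix i j
  have "smat_mult S (forward_subst S) i j
      = (\<Sum>k<i. S i k * forward_subst S k j) + S i i * forward_subst S i j"
    by (simp add: smat_mult_lower[OF lower_unitriangular_imp[OF assms]]
        flip: lessThan_Suc_atMost)
  also have "S i i * forward_subst S i j = smat_one i j - (\<Sum>k<i. S i k * forward_subst S k j)"
    using assms by (simp add: lower_unitriangular_def forward_subst.simps[of S i j])
  finally show "smat_mult S (forward_subst S) i j = smat_one i j" by simp
qed

lemma lower_unitriangular_inverse_ex1: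
  assumes S: "lower_unitriangular S"
  shows "\<exists>!T. lower_unitriangular T \<and> smat_mult S T = smat_one \<and> smat_mult T S = smat_one"
proof (rule ex_ex1I)
  define T where "T = forward_subst S"
  define R where "R = forward_subst T"
  have T: "lower_unitriangular T" and ST: "smat_mult S T = smat_one"
    using forward_subst_right_inverse[OF S]
    by (auto simp: T_def forward_subst_lower_unitriangular)
  have TR: "smat_mult T R = smat_one"
    using forward_subst_right_inverse[OF T] by (simp add: R_def)
  have "S = smat_mult S (smat_mult T R)"
    by (simp add: TR smat_one_right lower_unitriangular_imp S)
  also have "\<dots> = smat_mult (smat_mult S T) R"
    by (simp add: smat_mult_assoc lower_unitriangular_imp S T)
  also have "\<dots> = R" by (simp add: ST smat_one_left)
  finally have "smat_mult T S = smat_one" using TR by simp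
  thus "\<exists>T. lower_unitriangular T \<and> smat_mult S T = smat_one \<and> smat_mult T S = smat_one"
    using T ST by blast
next
  fix T R
  assume T: "lower_unitriangular T \<and> smat_mult S T = smat_one \<and> smat_mult T S = smat_one"
     and R: "lower_unitriangular R \<and> smat_mult S R = smat_one \<and> smat_mult R S = smat_one"
  have "T = smat_mult T (smat_mult S R)"
    using T R by (simp add: smat_one_right lower_unitriangular_imp)
  also have "\<dots> = smat_mult (smat_mult T S) R"
    by (rule smat_mult_assoc[symmetric]) (use T S in \<open>auto intro: lower_unitriangular_imp\<close>)
  also have "\<dots> = R" using T by (simp add: smat_one_left)
  finally show "T = R" .
qed

lemma smat_inv:
  assumes "lower_unitriangular S"
  shows "lower_unitriangular (smat_inv S)" "smat_mult S (smat_inv S) = smat_one"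
    "smat_mult (smat_inv S) S = smat_one"
  using theI'[OF lower_unitriangular_inverse_ex1[OF assms]] by (auto simp: smat_inv_def)

lemma smat_inv_mult_iff:
  assumes S: "lower_unitriangular S"
  shows "A = smat_mult (smat_inv S) B \<longleftrightarrow> smat_mult S A = B"
proof -
  have "smat_mult S (smat_mult (smat_inv S) B) = B" "smat_mult (smat_inv S) (smat_mult S A) = A"
    using smat_inv[OF S] S
    by (simp_all add: smat_mult_assoc[symmetric] lower_unitriangular_imp smat_one_left)
  thus ?thesis by auto
qed

lemma gauss_borel_iff:
  "gauss_borel G S1 H S2 \<longleftrightarrow> lower_unitriangular S1 \<and> lower_unitriangular S2 \<and>
     smat_mult S2 (smat_transpose (smat_mult S1 G)) = smat_diag H" (is "_ \<longleftrightarrow> ?R")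
proof (cases "lower_unitriangular S1 \<and> lower_unitriangular S2")
  case True
  note inv1 = smat_inv[OF conjunct1[OF True]] and inv2 = smat_inv[OF conjunct2[OF True]]
  have T2: "lower_triangular (smat_inv S2)" using inv2 lower_unitriangular_imp by blast
  have "gauss_borel G S1 H S2 \<longleftrightarrow>
      smat_mult S1 G = smat_mult (smat_diag H) (smat_transpose (smat_inv S2))"
    using True inv1
    by (simp add: gauss_borel_def smat_mult_assoc lower_triangular_diag lower_unitriangular_imp
        smat_inv_mult_iff)
  also have "\<dots> \<longleftrightarrow> smat_transpose (smat_mult S1 G) = smat_mult (smat_inv S2) (smat_diag H)"
    unfolding smat_diag_left smat_diag_right[OF T2] smat_transpose_def fun_eq_iff
    by (auto simp: mult.commute)
  also have "\<dots> \<longleftrightarrow> smat_mult S2 (smat_transpose (smat_mult S1 G)) = smat_diag H"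
    using True by (simp add: smat_inv_mult_iff)
  finally show ?thesis using True by simp
qed (auto simp: gauss_borel_def)

lemma gauss_borel_transpose:
  assumes "gauss_borel G S1 H S2"
  shows "gauss_borel (smat_transpose G) S2 H S1"
proof -
  from assms have S: "lower_unitriangular S1" "lower_unitriangular S2"
    by (auto simp: gauss_borel_def)
  define T1 T2 where "T1 = smat_inv S1" and "T2 = smat_inv S2"
  have T: "lower_triangular T1" "lower_triangular T2"
    using smat_inv(1) S lower_unitriangular_imp by (auto simp: T1_def T2_def)
  have fin: "smat_mult (smat_mult A (smat_diag H)) (smat_transpose B) i j
      = (\<Sum>k\<le>min i j. A i k * H k * B j k)"
    if "lower_triangular A" "lower_triangular B" for A B i j
    using that unfolding smat_diag_right[OF that(1)]
    by (subst smat_mult_finite[of "min i j"])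
       (auto simp: smat_transpose_def lower_triangular_def min_less_iff_disj)
  have G: "G i j = (\<Sum>k\<le>min i j. T1 i k * H k * T2 j k)" for i j
    using assms fin[OF T] by (simp add: gauss_borel_def T1_def T2_def)
  have "smat_transpose G = smat_mult (smat_mult T2 (smat_diag H)) (smat_transpose T1)"
  proof (intro ext)
    fix i j
    show "smat_transpose G i j
        = smat_mult (smat_mult T2 (smat_diag H)) (smat_transpose T1) i j"
      unfolding fin[OF T(2,1)] by (simp add: smat_transpose_def G min.commute mult_ac)
  qed
  thus ?thesis using S by (simp add: gauss_borel_def T1_def T2_def)
qed

lemma gauss_borel_row:
  assumes "gauss_borel G S1 H S2" and "l < n"
  shows "(\<Sum>j\<le>n. S1 n j * G j l) = 0"
proof -
  from assms have S: "lower_unitriangular S1" "lower_unitriangular S2"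
    by (auto simp: gauss_borel_def)
  have T2: "lower_triangular (smat_inv S2)" using smat_inv S lower_unitriangular_imp by blast
  have "smat_mult S1 G = smat_mult (smat_diag H) (smat_transpose (smat_inv S2))"
    using assms(1) smat_inv(1)[OF S(1)] S
    by (simp add: gauss_borel_def smat_mult_assoc lower_triangular_diag lower_unitriangular_imp
        smat_inv_mult_iff)
  hence "smat_mult S1 G n l = 0"
    unfolding smat_diag_left using T2 assms(2) by (simp add: smat_transpose_def lower_triangular_def)
  thus ?thesis by (simp add: smat_mult_lower[OF lower_unitriangular_imp[OF S(1)]])
qed

lemma leading_minor_0: "leading_minor G 0 = 1"
  by (simp add: leading_minor_def)

lemma leading_minor_transpose: "leading_minor (smat_transpose G) n = leading_minor G n"
proof -
  have "mat n n (\<lambda>(i, j). smat_transpose G i j) = transpose_mat (mat n n (\<lambda>(i, j). G i j))"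
    by (rule eq_matI) (auto simp: smat_transpose_def)
  thus ?thesis
    unfolding leading_minor_def by (metis det_transpose mat_carrier)
qed

lemma minor_kernel:
  assumes "leading_minor G n \<noteq> 0" "\<And>l. l < n \<Longrightarrow> (\<Sum>j<n. f j * G j l) = 0" "j < n"
  shows "f j = 0"
proof (rule ccontr)
  assume nz: "f j \<noteq> 0"
  define A where "A = mat n n (\<lambda>(i, j). smat_transpose G i j)"
  have A: "A \<in> carrier_mat n n" by (simp add: A_def)
  have "det A \<noteq> 0"
    using assms(1) leading_minor_transpose[of G n] by (simp add: leading_minor_def A_def)
  moreover have "A *\<^sub>v vec n f = 0\<^sub>v n"
    using assms(2) by (intro eq_vecI)
      (auto simp: A_def scalar_prod_def smat_transpose_def mult.commute atLeast0LessThan)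
  moreover have "vec n f \<noteq> 0\<^sub>v n"
  proof
    assume "vec n f = 0\<^sub>v n"
    hence "vec n f $ j = 0\<^sub>v n $ j" by simp
    thus False using nz assms(3) by simp
  qed
  ultimately show False
    using det_0_iff_vec_prod_zero_field[OF A] vec_carrier by blast
qed

lemma minor_solve:
  assumes "leading_minor G n \<noteq> 0"
  shows "\<exists>f. \<forall>l<n. (\<Sum>j<n. f j * G j l) = b l"
proof -
  define A where "A = mat n n (\<lambda>(i, j). smat_transpose G i j)"
  have A: "A \<in> carrier_mat n n" by (simp add: A_def)
  have "det A \<noteq> 0"
    using assms(1) leading_minor_transpose[of G n] by (simp add: leading_minor_def A_def)
  from det_non_zero_imp_unit[OF A this, of "()"]
  obtain B where B: "B \<in> carrier_mat n n" "A * B = 1\<^sub>m n"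
    by (auto simp: Units_def ring_mat_def)
  define v where "v = B *\<^sub>v vec n b"
  have v: "v \<in> carrier_vec n" using B by (simp add: v_def)
  have Av: "A *\<^sub>v v = vec n b"
    unfolding v_def using A B by (simp flip: assoc_mult_mat_vec)
  have "(\<Sum>j<n. v $ j * G j l) = b l" if "l < n" for l
  proof -
    have "(A *\<^sub>v v) $ l = (\<Sum>j<n. v $ j * G j l)"
      using that v
      by (auto simp: A_def scalar_prod_def smat_transpose_def mult.commute atLeast0LessThan)
    thus ?thesis using Av that by simp
  qed
  thus ?thesis by (intro exI[of _ "\<lambda>j. v $ j"]) auto
qed

lemma orthogonal_rows_exist:
  assumes "\<And>n. leading_minor G n \<noteq> 0"
  shows "\<exists>S. lower_unitriangular S \<and> (\<forall>n l. l < n \<longrightarrow> (\<Sum>j\<le>n. S n j * G j l) = 0)"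
proof -
  have "\<forall>n. \<exists>f. \<forall>l<n. (\<Sum>j<n. f j * G j l) = - G n l"
    by (intro allI minor_solve assms)
  from choice[OF this]
  obtain F where "\<forall>n. \<forall>l<n. (\<Sum>j<n. F n j * G j l) = - G n l" ..
  hence F: "(\<Sum>j<n. F n j * G j l) = - G n l" if "l < n" for n l
    using that by simp
  define S where "S = (\<lambda>n j. if j < n then F n j else if j = n then 1 else 0)"
  have "(\<Sum>j\<le>n. S n j * G j l) = 0" if "l < n" for n l
    using F[OF that] by (simp add: S_def flip: lessThan_Suc_atMost)
  moreover have "lower_unitriangular S" by (auto simp: S_def lower_unitriangular_def)
  ultimately show ?thesis by blast
qed

lemma orthogonal_rows_unique:
  assumes "\<And>n. leading_minor G n \<noteq> 0"
    and "lower_unitriangular S" "\<And>n l. l < n \<Longrightarrow> (\<Sum>j\<le>n. S n j * G j l) = 0"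
    and "lower_unitriangular S'" "\<And>n l. l < n \<Longrightarrow> (\<Sum>j\<le>n. S' n j * G j l) = 0"
  shows "S = S'"
proof (intro ext)
  fix n j
  show "S n j = S' n j"
  proof (cases "j < n")
    case True
    have "S n j - S' n j = 0"
    proof (rule minor_kernel[OF assms(1) _ True, of "\<lambda>j. S n j - S' n j"])
      fix l assume "l < n"
      from assms(3,5)[OF this] assms(2,4)
      show "(\<Sum>j<n. (S n j - S' n j) * G j l) = 0"
        by (simp add: lower_unitriangular_def left_diff_distrib sum_subtractf
            flip: lessThan_Suc_atMost)
           (metis add_right_imp_eq)
    qed
    thus ?thesis by simp
  next
    case False
    thus ?thesis using assms(2,4)
      by (cases "j = n") (auto simp: lower_unitriangular_def)
  qed
qed

theorem gauss_borel_ex1: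
  assumes "quasi_definite u"
  shows "\<exists>!(S1, H, S2). gauss_borel (gram u) S1 H S2"
proof -
  define G where "G = gram u"
  have minor: "leading_minor G n \<noteq> 0" for n
    using assms by (cases "n \<ge> 1") (auto simp: quasi_definite_def G_def not_le leading_minor_0)
  hence minor': "leading_minor (smat_transpose G) n \<noteq> 0" for n
    by (simp add: leading_minor_transpose)
  obtain S1 where S1: "lower_unitriangular S1" "\<And>n l. l < n \<Longrightarrow> (\<Sum>j\<le>n. S1 n j * G j l) = 0"
    using orthogonal_rows_exist[OF minor] by blast
  obtain S2 where S2: "lower_unitriangular S2"
      "\<And>n l. l < n \<Longrightarrow> (\<Sum>j\<le>n. S2 n j * smat_transpose G j l) = 0"
    using orthogonal_rows_exist[OF minor'] by blast
  define D where "D = smat_mult S2 (smat_transpose (smat_mult S1 G))"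
  have D: "D i j = (\<Sum>k\<le>i. \<Sum>l\<le>j. S2 i k * (S1 j l * G l k))" for i j
    using S1(1) S2(1)
    by (simp add: D_def smat_mult_lower lower_unitriangular_imp smat_transpose_def sum_distrib_left)
  have "D i j = 0" if "i \<noteq> j" for i j
  proof (cases "i < j")
    case True
    have "D i j = (\<Sum>k\<le>i. S2 i k * (\<Sum>l\<le>j. S1 j l * G l k))"
      by (simp add: D sum_distrib_left)
    also have "\<dots> = 0" using True by (intro sum.neutral) (auto simp: S1(2))
    finally show ?thesis .
  next
    case False
    have "D i j = (\<Sum>l\<le>j. \<Sum>k\<le>i. S2 i k * (S1 j l * G l k))"
      unfolding D by (rule sum.swap)
    also have "\<dots> = (\<Sum>l\<le>j. S1 j l * (\<Sum>k\<le>i. S2 i k * smat_transpose G k l))"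
      by (simp add: sum_distrib_left smat_transpose_def mult_ac)
    also have "\<dots> = 0" using False that by (intro sum.neutral) (auto simp: S2(2))
    finally show ?thesis .
  qed
  hence "D = smat_diag (\<lambda>i. D i i)" by (auto simp: smat_diag_def fun_eq_iff)
  hence ex: "gauss_borel G S1 (\<lambda>i. D i i) S2"
    using S1(1) S2(1) by (simp add: gauss_borel_iff D_def)
  have uniq: "R1 = S1 \<and> K = (\<lambda>i. D i i) \<and> R2 = S2" if gb: "gauss_borel G R1 K R2" for R1 K R2
  proof -
    have R: "lower_unitriangular R1" "lower_unitriangular R2"
      using gb by (auto simp: gauss_borel_def)
    have "R1 = S1"
      by (rule orthogonal_rows_unique[OF minor R(1) gauss_borel_row[OF gb] S1])
    moreover have "R2 = S2"
      by (rule orthogonal_rows_unique[OF minor' R(2)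
            gauss_borel_row[OF gauss_borel_transpose[OF gb]] S2])
    ultimately have "smat_diag K = D" using gb by (simp add: gauss_borel_iff D_def)
    hence "K i = D i i" for i by (metis smat_diag_def)
    with \<open>R1 = S1\<close> \<open>R2 = S2\<close> show ?thesis by auto
  qed
  show ?thesis
    unfolding G_def[symmetric]
  proof (rule ex1I)
    show "case (S1, \<lambda>i. D i i, S2) of (S1, H, S2) \<Rightarrow> gauss_borel G S1 H S2"
      using ex by simp
  next
    fix t assume "case t of (S1, H, S2) \<Rightarrow> gauss_borel G S1 H S2"
    hence "gauss_borel G (fst t) (fst (snd t)) (snd (snd t))" by (simp add: case_prod_beta)
    from uniq[OF this] show "t = (S1, \<lambda>i. D i i, S2)" by (metis prod.collapse)
  qed
qed

lemma gauss_borel_factors: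
  assumes "quasi_definite u"
  shows "gauss_borel (gram u) (S1_of u) (H_of u) (S2_of u)"
proof -
  have "case gb_factors u of (S1, H, S2) \<Rightarrow> gauss_borel (gram u) S1 H S2"
    unfolding gb_factors_def by (rule theI'[OF gauss_borel_ex1[OF assms]])
  thus ?thesis by (simp add: S1_of_def H_of_def S2_of_def case_prod_beta)
qed

end

theory Submission
  imports Defs
begin

text \<open>
  The whole statement rests on biorthogonality: read entry by entry, the factorization
  \<open>S\<^sub>1 G S\<^sub>2\<^sup>T = H\<close> says that \<open>P\<^sub>1\<^sub>,\<^sub>i\<close> and \<open>P\<^sub>2\<^sub>,\<^sub>j\<close> pair to \<open>H\<^sub>i\<close> if \<open>i = j\<close> and to \<open>0\<close> otherwise
  (lemma \<open>biorthogonality\<close>). With one variable set to \<open>z\<close>, the Christoffel--Darboux kernel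
  is an explicit linear combination of the first \<open>n + 1\<close> biorthogonal polynomials in the other
  variable; pairing it with a finite combination of the dual family therefore leaves a single
  sum, in which the factor \<open>H\<^sub>k\<close> from the pairing meets the factor \<open>1 / H\<^sub>k\<close> from the kernel
  (lemma \<open>kform_expansions\<close>). The two cancel because \<open>H\<^sub>k \<noteq> 0\<close> (lemma \<open>H_of_nonzero\<close>), which
  is where the nonvanishing of the minors enters: if \<open>H\<^sub>k\<close> were zero, row \<open>k\<close> of \<open>S\<^sub>1\<close> would be a
  nontrivial linear relation between the rows of the leading block of \<open>G\<close> of size \<open>k + 1\<close>.

  The reproducing property for \<open>y\<^sup>l\<close> is the special case in which the coefficients are row \<open>l\<close>
  of \<open>S\<^sub>2\<^sup>-\<^sup>1\<close>: this row is supported on \<open>{0..l}\<close>, so for \<open>l \<le> n\<close> the truncation at \<open>n\<close> loses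
  nothing.
\<close>

section \<open>Bilinearity of the form\<close>

lemma bivar_prod_sum_left: "bivar_prod (\<Sum>i\<in>I. f i) Q = (\<Sum>i\<in>I. bivar_prod (f i) Q)"
  by (induction I rule: infinite_finite_induct) (simp_all add: bivar_prod_def smult_add_left)

lemma bivar_prod_smult_left: "bivar_prod (smult c P) Q = smult [:c:] (bivar_prod P Q)"
  by (simp add: bivar_prod_def)

lemma bivar_prod_add_right: "bivar_prod P (Q + R) = bivar_prod P Q + bivar_prod P R"
  by (rule poly_eqI) (simp add: bivar_prod_def coeff_map_poly algebra_simps flip: smult_add_left)

lemma bivar_prod_sum_right: "bivar_prod P (\<Sum>i\<in>I. f i) = (\<Sum>i\<in>I. bivar_prod P (f i))"
  by (induction I rule: infinite_finite_induct)
     (simp_all add: bivar_prod_add_right, simp_all add: bivar_prod_def)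

lemma bivar_prod_smult_right: "bivar_prod P (smult c Q) = smult [:c:] (bivar_prod P Q)"
  by (rule poly_eqI) (simp add: bivar_prod_def coeff_map_poly mult.commute)

lemma generalized_kernel_sum:
  assumes "generalized_kernel u"
  shows "u (\<Sum>i\<in>I. F i) = (\<Sum>i\<in>I. u (F i))"
proof -
  interpret Vector_Spaces.linear "\<lambda>c. smult [:c:]" "(*)" u
    using assms by (simp add: generalized_kernel_def)
  show ?thesis by (rule sum)
qed

lemma generalized_kernel_smult:
  assumes "generalized_kernel u"
  shows "u (smult [:c:] F) = c * u F"
proof -
  interpret Vector_Spaces.linear "\<lambda>c. smult [:c:]" "(*)" u
    using assms by (simp add: generalized_kernel_def)
  show ?thesis by (rule scale)
qed

lemma kform_bilinear:
  assumes "generalized_kernel u"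
  shows "kform u (\<Sum>i\<in>I. smult (a i) (f i)) (\<Sum>j\<in>J. smult (b j) (g j))
    = (\<Sum>i\<in>I. \<Sum>j\<in>J. a i * b j * kform u (f i) (g j))"
proof -
  have "kform u (\<Sum>i\<in>I. smult (a i) (f i)) (\<Sum>j\<in>J. smult (b j) (g j))
      = (\<Sum>j\<in>J. \<Sum>i\<in>I. a i * b j * kform u (f i) (g j))"
    by (simp add: kform_def bivar_prod_sum_left bivar_prod_sum_right bivar_prod_smult_left
        bivar_prod_smult_right generalized_kernel_sum[OF assms]
        generalized_kernel_smult[OF assms] sum_distrib_left mult_ac del: smult_smult)
  thus ?thesis by (subst sum.swap)
qed

section \<open>Biorthogonality\<close>

lemma smat_mult_vec_lower:
  assumes "lower_triangular S"
  shows "smat_mult_vec S v k = (\<Sum>j\<le>k. smult (S k j) (v j))"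
  unfolding smat_mult_vec_def
  by (rule Sum_any.expand_superset) (use assms in \<open>auto simp: lower_triangular_def not_le[symmetric]\<close>)

lemma smult_sum_right: "smult c (\<Sum>i\<in>I. f i) = (\<Sum>i\<in>I. smult c (f i))"
  by (induction I rule: infinite_finite_induct) (simp_all add: smult_add_right)

lemma smat_mult_vec_assoc:
  assumes "lower_triangular A" "lower_triangular B"
  shows "smat_mult_vec A (smat_mult_vec B v) = smat_mult_vec (smat_mult A B) v"
proof
  fix i
  have "smat_mult_vec A (smat_mult_vec B v) i
      = (\<Sum>j\<le>i. \<Sum>k\<le>j. smult (A i j * B j k) (v k))"
    using assms by (simp add: smat_mult_vec_lower smult_sum_right)
  also have "\<dots> = (\<Sum>j\<le>i. \<Sum>k\<le>i. smult (A i j * B j k) (v k))"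
    by (intro sum.cong[OF refl] sum.mono_neutral_left)
       (use assms in \<open>auto simp: lower_triangular_def\<close>)
  also have "\<dots> = (\<Sum>k\<le>i. \<Sum>j\<le>i. smult (A i j * B j k) (v k))"
    by (rule sum.swap)
  also have "\<dots> = smat_mult_vec (smat_mult A B) v i"
    using assms
    by (simp add: smat_mult_vec_lower lower_triangular_mult smat_mult_lower smult_sum)
  finally show "smat_mult_vec A (smat_mult_vec B v) i = smat_mult_vec (smat_mult A B) v i" .
qed

lemma smat_mult_vec_one: "smat_mult_vec smat_one v = v"
proof
  fix k
  have "smat_mult_vec smat_one v k = (\<Sum>j\<le>k. if k = j then v j else 0)"
    unfolding smat_mult_vec_lower[OF lower_triangular_one]
    by (rule sum.cong) (simp_all add: smat_one_def)
  thus "smat_mult_vec smat_one v k = v k" by simp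
qed

context
  fixes u :: "complex poly poly \<Rightarrow> complex"
  assumes qd: "quasi_definite u"
begin

lemma S1_of_lower_unitriangular: "lower_unitriangular (S1_of u)"
  and S2_of_lower_unitriangular: "lower_unitriangular (S2_of u)"
  using gauss_borel_factors[OF qd] by (auto simp: gauss_borel_def)

lemma P1_expansion: "P1 u k = (\<Sum>j\<le>k. smult (S1_of u k j) (chi j))"
  by (simp add: P1_def smat_mult_vec_lower lower_unitriangular_imp S1_of_lower_unitriangular)

lemma P2_expansion: "P2 u k = (\<Sum>j\<le>k. smult (S2_of u k j) (chi j))"
  by (simp add: P2_def smat_mult_vec_lower lower_unitriangular_imp S2_of_lower_unitriangular)

lemma diagonalized_gram:
  "(\<Sum>k\<le>i. \<Sum>l\<le>j. S1_of u i k * S2_of u j l * gram u k l) = (if i = j then H_of u i else 0)"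
proof -
  note S = S1_of_lower_unitriangular S2_of_lower_unitriangular
  have "smat_mult (S2_of u) (smat_transpose (smat_mult (S1_of u) (gram u))) j i
      = smat_diag (H_of u) j i"
    using gauss_borel_factors[OF qd] by (simp add: gauss_borel_iff)
  hence "(\<Sum>l\<le>j. \<Sum>k\<le>i. S1_of u i k * S2_of u j l * gram u k l) = smat_diag (H_of u) j i"
    using S by (simp add: smat_mult_lower lower_unitriangular_imp smat_transpose_def
        sum_distrib_left mult_ac)
  thus ?thesis by (subst sum.swap) (auto simp: smat_diag_def)
qed

theorem biorthogonality:
  assumes "generalized_kernel u"
  shows "kform u (P1 u i) (P2 u j) = (if i = j then H_of u i else 0)"
proof -
  have "kform u (P1 u i) (P2 u j)
      = (\<Sum>k\<le>i. \<Sum>l\<le>j. S1_of u i k * S2_of u j l * gram u k l)"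
    by (simp add: P1_expansion P2_expansion kform_bilinear[OF assms] chi_def gram_def)
  thus ?thesis by (simp only: diagonalized_gram)
qed

text \<open>
  Row \<open>k\<close> of \<open>S\<^sub>1\<close> annihilates the first \<open>k\<close> columns of the Gram matrix, and its product with
  column \<open>k\<close> is \<open>H\<^sub>k\<close>. If \<open>H\<^sub>k\<close> vanished, the row would be a left null vector of an invertible
  leading block although its diagonal entry is \<open>1\<close>.
\<close>

lemma H_of_nonzero: "H_of u k \<noteq> 0"
proof
  assume H: "H_of u k = 0"
  have row: "(\<Sum>j\<le>k. S1_of u k j * gram u j l) = 0" if "l < k" for l
    using gauss_borel_row[OF gauss_borel_factors[OF qd] that] .
  have "H_of u k = (\<Sum>l\<le>k. S2_of u k l * (\<Sum>j\<le>k. S1_of u k j * gram u j l))"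
    using diagonalized_gram[of k k]
    by (subst (asm) sum.swap) (simp add: sum_distrib_left mult_ac)
  also have "\<dots> = S2_of u k k * (\<Sum>j\<le>k. S1_of u k j * gram u j k)"
    by (subst lessThan_Suc_atMost[symmetric], subst sum.lessThan_Suc) (simp add: row)
  also have "S2_of u k k = 1"
    using S2_of_lower_unitriangular by (simp add: lower_unitriangular_def)
  finally have diag: "(\<Sum>j\<le>k. S1_of u k j * gram u j k) = 0"
    using H by simp
  have "S1_of u k k = 0"
  proof (rule minor_kernel[of "gram u" "Suc k" "S1_of u k"])
    show "leading_minor (gram u) (Suc k) \<noteq> 0"
      using qd by (simp add: quasi_definite_def)
    show "(\<Sum>j<Suc k. S1_of u k j * gram u j l) = 0" if "l < Suc k" for l
      using that row[of l] diag by (cases "l = k") (auto simp only: lessThan_Suc_atMost less_Suc_eq)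
  qed simp
  thus False
    using S1_of_lower_unitriangular by (simp add: lower_unitriangular_def)
qed

text \<open>This is row \<open>l\<close> of the identity \<open>\<chi> = S\<^sub>2\<^sup>-\<^sup>1 (S\<^sub>2 \<chi>)\<close>.\<close>

lemma monom_expansion_P2:
  "monom 1 l = (\<Sum>j\<le>l. smult (smat_inv (S2_of u) l j) (P2 u j))"
proof -
  note S = S2_of_lower_unitriangular
  note T = smat_inv[OF S]
  have "smat_mult_vec (smat_inv (S2_of u)) (P2 u) = chi"
    by (simp add: P2_def smat_mult_vec_assoc T S lower_unitriangular_imp smat_mult_vec_one)
  thus ?thesis
    by (simp add: chi_def smat_mult_vec_lower[OF lower_unitriangular_imp[OF T(1)]] fun_eq_iff)
qed

text \<open>
  A Parseval identity. The two truncation orders are independent because in the applications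
  one is that of the kernel and the other that of the polynomial it is paired with.
\<close>

lemma kform_expansions:
  assumes "generalized_kernel u"
  shows "kform u (\<Sum>i\<le>p. smult (a i) (P1 u i)) (\<Sum>j\<le>q. smult (b j) (P2 u j))
    = (\<Sum>k\<le>min p q. a k * b k * H_of u k)"
proof -
  have "kform u (\<Sum>i\<le>p. smult (a i) (P1 u i)) (\<Sum>j\<le>q. smult (b j) (P2 u j))
      = (\<Sum>i\<le>p. if i \<le> q then a i * b i * H_of u i else 0)"
    by (simp add: kform_bilinear[OF assms] biorthogonality[OF assms]
        if_distrib[of "\<lambda>x. _ * x"] cong: if_cong)
  also have "\<dots> = (\<Sum>k\<le>min p q. a k * b k * H_of u k)"
    by (rule sum.mono_neutral_cong_right) auto
  finally show ?thesis .
qed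

end

section \<open>Reproducing property of the Christoffel--Darboux kernel\<close>

lemma eval_snd_bivar_prod: "eval_snd (bivar_prod P Q) z = smult (poly Q z) P"
proof -
  have "poly (map_poly (\<lambda>c. [:c:]) Q) [:z:] = [:poly Q z:]"
    by (induction Q) (simp_all add: map_poly_pCons)
  thus ?thesis by (simp add: eval_snd_def bivar_prod_def)
qed

lemma eval_fst_bivar_prod: "eval_fst (bivar_prod P Q) z = smult (poly P z) Q"
  by (rule poly_eqI) (simp add: eval_fst_def bivar_prod_def coeff_map_poly)

lemma eval_fst_sum: "eval_fst (\<Sum>i\<in>I. F i) z = (\<Sum>i\<in>I. eval_fst (F i) z)"
  by (rule poly_eqI) (simp add: eval_fst_def coeff_map_poly coeff_sum poly_sum)

lemma eval_snd_CD_kernel: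
  "eval_snd (CD_kernel u n) z = (\<Sum>k\<le>n. smult (poly (P2 u k) z / H_of u k) (P1 u k))"
proof -
  have "eval_snd (CD_kernel u n) z
      = (\<Sum>k\<le>n. eval_snd (smult [:inverse (H_of u k):] (bivar_prod (P1 u k) (P2 u k))) z)"
    by (simp add: CD_kernel_def eval_snd_def poly_sum)
  thus ?thesis
    by (simp add: eval_snd_bivar_prod divide_inverse mult.commute flip: bivar_prod_smult_left)
qed

lemma eval_fst_CD_kernel:
  "eval_fst (CD_kernel u n) z = (\<Sum>k\<le>n. smult (poly (P1 u k) z / H_of u k) (P2 u k))"
  by (simp add: CD_kernel_def eval_fst_sum eval_fst_bivar_prod divide_inverse mult.commute
      flip: bivar_prod_smult_left)

lemma CD_kernel_reproduces_P2:
  assumes "generalized_kernel u" "quasi_definite u" "\<And>j. j > m \<Longrightarrow> lam j = 0"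
  shows "kform u (eval_snd (CD_kernel u n) z) (\<Sum>j\<le>m. smult (lam j) (P2 u j))
    = (\<Sum>j\<le>n. lam j * poly (P2 u j) z)"
proof -
  have "kform u (eval_snd (CD_kernel u n) z) (\<Sum>j\<le>m. smult (lam j) (P2 u j))
      = (\<Sum>k\<le>min n m. lam k * poly (P2 u k) z)"
    by (simp add: eval_snd_CD_kernel kform_expansions assms(1,2) H_of_nonzero mult.commute)
  also have "\<dots> = (\<Sum>k\<le>n. lam k * poly (P2 u k) z)"
    by (rule sum.mono_neutral_left) (auto simp: assms(3))
  finally show ?thesis .
qed

lemma CD_kernel_reproduces_P1:
  assumes "generalized_kernel u" "quasi_definite u" "\<And>j. j > m \<Longrightarrow> lam j = 0"
  shows "kform u (\<Sum>j\<le>m. smult (lam j) (P1 u j)) (eval_fst (CD_kernel u n) z)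
    = (\<Sum>j\<le>n. lam j * poly (P1 u j) z)"
proof -
  have "kform u (\<Sum>j\<le>m. smult (lam j) (P1 u j)) (eval_fst (CD_kernel u n) z)
      = (\<Sum>k\<le>min m n. lam k * poly (P1 u k) z)"
    by (simp add: eval_fst_CD_kernel kform_expansions assms(1,2) H_of_nonzero)
  also have "\<dots> = (\<Sum>k\<le>n. lam k * poly (P1 u k) z)"
    by (rule sum.mono_neutral_left) (auto simp: assms(3))
  finally show ?thesis .
qed

lemma CD_kernel_reproduces_monom:
  assumes "generalized_kernel u" "quasi_definite u" "l \<le> n"
  shows "kform u (eval_snd (CD_kernel u n) z) (monom 1 l) = z ^ l"
proof -
  define lam where "lam = smat_inv (S2_of u) l"
  have lam0: "lam j = 0" if "j > l" for j
    using smat_inv(1)[OF S2_of_lower_unitriangular[OF assms(2)]] that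
    by (simp add: lam_def lower_unitriangular_def)
  have monom: "monom 1 l = (\<Sum>j\<le>l. smult (lam j) (P2 u j))"
    unfolding lam_def by (rule monom_expansion_P2[OF assms(2)])
  have "kform u (eval_snd (CD_kernel u n) z) (monom 1 l) = (\<Sum>j\<le>n. lam j * poly (P2 u j) z)"
    unfolding monom by (rule CD_kernel_reproduces_P2[OF assms(1,2) lam0])
  also have "\<dots> = (\<Sum>j\<le>l. lam j * poly (P2 u j) z)"
    by (rule sum.mono_neutral_right) (use assms(3) lam0 in auto)
  also have "\<dots> = poly (monom 1 l) z"
    by (simp add: monom poly_sum)
  finally show ?thesis by (simp add: poly_monom)
qed

theorem proposition12:
  fixes u :: "complex poly poly \<Rightarrow> complex" and n :: nat
  assumes "generalized_kernel u" and "quasi_definite u"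
  shows "(\<forall>(m::nat) (lam :: nat \<Rightarrow> complex) (z::complex). (\<forall>j>m. lam j = 0) \<longrightarrow>
            kform u (eval_snd (CD_kernel u n) z) (\<Sum>j\<le>m. smult (lam j) (P2 u j))
              = (\<Sum>j\<le>n. lam j * poly (P2 u j) z) \<and>
            kform u (\<Sum>j\<le>m. smult (lam j) (P1 u j)) (eval_fst (CD_kernel u n) z)
              = (\<Sum>j\<le>n. lam j * poly (P1 u j) z)) \<and>
         (\<forall>(l::nat) (z::complex). l \<le> n \<longrightarrow>
            kform u (eval_snd (CD_kernel u n) z) (monom 1 l) = z ^ l)"
  using CD_kernel_reproduces_P2[OF assms] CD_kernel_reproduces_P1[OF assms]
    CD_kernel_reproduces_monom[OF assms] by blast

end
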